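(* Let $\lambda$ be a nonzero real number and let $$F(t)=F(t;\lambda)=\frac{\lambda}{(1+t)^\lambda-1},\qquad t\in(-1,0)\cup(0,\infty).$$ For integers $N\ge 1$ and $0\le i\le N$ define numbers $a_{i,\lambda}(N)$ by $$a_{0,\lambda}(N)=(N+\lambda-1)_N,\qquad a_{N,\lambda}(N)=N!,$$ and, for $1\le i\le N-1$, $$a_{i,\lambda}(N)= i!\,(N+(i+1)\lambda-1)_{N-i}+ i\sum_{l=0}^{N-i-1}(N+(i+1)\lambda-1)_l\, a_{i-1,\lambda}(N-l-1).$$ Then for every $N=1,2,3,\dots$, $F$ satisfies the nonlinear differential equation $$(-1)^N(1+t)^N F^{(N)}(t)=\sum_{i=0}^N a_{i,\lambda}(N)\,F(t)^{i+1}.$$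
   Context: $(x)_n$ denotes the falling factorial: $(x)_0=1$ and $(x)_n=x(x-1)\cdots(x-n+1)$ for $n\ge 1$. $F^{(N)}$ denotes the $N$-th derivative of $F$ with respect to $t$. The recurrence for $a_{i,\lambda}(N)$ with $1\le i\le N-1$ is applied recursively in $i$ (it uses only values $a_{i-1,\lambda}(M)$ with $M<N$). *)

theory Defs
  imports "HOL-Analysis.Analysis"
begin

definition falling_factorial :: "real \<Rightarrow> nat \<Rightarrow> real" where
  "falling_factorial x n = (\<Prod>k<n. x - real k)"

(* Only the values on (-1,0) and (0,\<infinity>) are meaningful.  Since this set is open, derivatives at
   its points do not depend on the values elsewhere. *)
definition F :: "real \<Rightarrow> real \<Rightarrow> real" where
  "F lam t = lam / ((1 + t) powr lam - 1)"

(* coeff_a lam i N is the number a_{i,lam}(N), meant for N \<ge> 1 and i \<le> N.  In the last branch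
   with i < N, the recursive calls are made at (i - 1, M) with i \<le> M < N, hence stay in that range;
   the values for i > N or N = 0 are irrelevant. *)
fun coeff_a :: "real \<Rightarrow> nat \<Rightarrow> nat \<Rightarrow> real" where
  "coeff_a lam 0 N = falling_factorial (real N + lam - 1) N"
| "coeff_a lam (Suc j) N =
     (let i = Suc j; x = real N + (real i + 1) * lam - 1 in
      if i = N then fact N
      else fact i * falling_factorial x (N - i)
           + real i * (\<Sum>l = 0..N - i - 1. falling_factorial x l * coeff_a lam j (N - l - 1)))"

end

theory Submission
  imports Defs
begin

(* With u = (1+t)^lam the function F satisfies the Riccati equation -(1+t) F' = lam F + F^2.
   Hence, if (-1)^N (1+t)^N F^(N) is a polynomial in F with coefficients a_i(N), so is the next one,
   with a_i(N+1) = (N + (i+1) lam) a_i(N) + i a_(i-1)(N).  Unrolling this one-step recurrence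
   in N down to N = i gives the sum that defines a_i(N). *)

lemma falling_factorial_Suc_shift:
  "falling_factorial (x + 1) (Suc n) = (x + 1) * falling_factorial x n"
  unfolding falling_factorial_def prod.lessThan_Suc_shift by (simp add: algebra_simps)

lemma coeff_a_diag: "coeff_a lam N N = fact N"
  by (cases N) (simp_all add: falling_factorial_def Let_def)

lemma coeff_a_below_diag:
  assumes "Suc j < N"
  shows "coeff_a lam (Suc j) N =
    fact (Suc j) * falling_factorial (real N + (real j + 2) * lam - 1) (N - Suc j)
    + (real j + 1) * (\<Sum>l<N - Suc j.
        falling_factorial (real N + (real j + 2) * lam - 1) l * coeff_a lam j (N - l - 1))"
proof -
  \<comment> \<open>Strictness matters: for \<open>N = Suc j\<close> truncated subtraction turns the
    left side into \<open>{0}\<close>, while the right side is empty.\<close>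
  have "{0..N - Suc j - 1} = {..<N - Suc j}"
    using assms by auto
  then show ?thesis
    using assms by (simp add: Let_def add_ac)
qed

lemma coeff_a_0_Suc: "coeff_a lam 0 (Suc N) = (real N + lam) * coeff_a lam 0 N"
  using falling_factorial_Suc_shift[of "real N + lam - 1" N] by (simp add: add_ac)

text \<open>Raising \<open>N\<close> by one raises the argument of every falling factorial by one,
  so \<open>falling_factorial_Suc_shift\<close> pulls the common factor \<open>x + 1\<close> out of
  all terms except \<open>l = 0\<close>, which leaves \<open>coeff_a lam j N\<close>.\<close>

lemma coeff_a_Suc_Suc:
  assumes "Suc j \<le> N"
  shows "coeff_a lam (Suc j) (Suc N) =
    (real N + (real j + 2) * lam) * coeff_a lam (Suc j) N + (real j + 1) * coeff_a lam j N"
proof -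
  define x where "x = real N + (real j + 2) * lam - 1"
  define n where "n = N - Suc j"
  have x: "real (Suc N) + (real j + 2) * lam - 1 = x + 1"
    and x1: "real N + (real j + 2) * lam = x + 1"
    by (simp_all add: x_def)
  have n: "Suc N - Suc j = Suc n"
    using assms by (simp add: n_def)
  \<comment> \<open>The formula for \<open>i < N\<close> extends to the diagonal: there
    \<open>n = 0\<close>, the sum is empty and the product is 1, which leaves
    \<open>fact N\<close>.\<close>
  have unrolled: "coeff_a lam (Suc j) N = fact (Suc j) * falling_factorial x n
      + (real j + 1) * (\<Sum>l<n. falling_factorial x l * coeff_a lam j (N - l - 1))"
  proof (cases "Suc j = N")
    case True
    then show ?thesis
      using coeff_a_diag[of lam N] by (simp add: n_def falling_factorial_def del: coeff_a.simps)
  next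
    case False
    then show ?thesis
      using assms coeff_a_below_diag[of j N lam] by (simp add: x_def n_def)
  qed
  have "coeff_a lam (Suc j) (Suc N) = fact (Suc j) * falling_factorial (x + 1) (Suc n)
      + (real j + 1) * (\<Sum>l<Suc n. falling_factorial (x + 1) l * coeff_a lam j (Suc N - l - 1))"
    using coeff_a_below_diag[of j "Suc N" lam] assms unfolding x n by simp
  also have "(\<Sum>l<Suc n. falling_factorial (x + 1) l * coeff_a lam j (Suc N - l - 1))
      = coeff_a lam j N
        + (x + 1) * (\<Sum>l<n. falling_factorial x l * coeff_a lam j (N - l - 1))"
    unfolding sum.lessThan_Suc_shift falling_factorial_Suc_shift
    by (simp add: falling_factorial_def sum_distrib_left mult.assoc)
  finally show ?thesis
    unfolding unrolled x1 falling_factorial_Suc_shift by (simp add: algebra_simps)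
qed

text \<open>For \<open>N = 0\<close> this is just \<open>y\<close>, so the induction on derivatives
  can start at \<open>F\<close> itself.\<close>

definition coeff_poly :: "real \<Rightarrow> nat \<Rightarrow> real \<Rightarrow> real" where
  "coeff_poly lam N y = (\<Sum>i\<le>N. coeff_a lam i N * y ^ (i + 1))"

text \<open>The one-step recurrence in polynomial form: the sum on the right is the derivative of
  \<open>coeff_poly lam N\<close> at \<open>y\<close>, and the factor
  \<open>lam * y + y\<^sup>2\<close> comes from the Riccati equation.\<close>

lemma coeff_poly_Suc:
  "coeff_poly lam (Suc N) y = real N * coeff_poly lam N y
    + (\<Sum>i\<le>N. coeff_a lam i N * (real (i + 1) * y ^ i)) * (lam * y + y\<^sup>2)"
proof -
  \<comment> \<open>The cutoff makes \<open>b (Suc N) = 0\<close>, so that \<open>step\<close> also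
    covers the top coefficient \<open>j = N\<close>, where it reads (N+1)! = (N+1) N!.\<close>
  define b where "b i = (if i \<le> N then (real N + (real i + 1) * lam) * coeff_a lam i N else 0)" for i
  have step: "coeff_a lam (Suc j) (Suc N) = b (Suc j) + (real j + 1) * coeff_a lam j N"
    if "j \<le> N" for j
  proof (cases "j = N")
    case True
    then show ?thesis
      by (simp only: coeff_a_diag) (simp add: b_def)
  next
    case False
    then show ?thesis
      using that coeff_a_Suc_Suc[of j N lam] by (simp add: b_def add_ac)
  qed
  have "coeff_poly lam (Suc N) y
      = b 0 * y + (\<Sum>j\<le>N. (b (Suc j) + (real j + 1) * coeff_a lam j N) * y ^ (j + 2))"
    unfolding coeff_poly_def sum.atMost_Suc_shift
    using coeff_a_0_Suc[of lam N] step by (simp add: b_def del: coeff_a.simps)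
  also have "\<dots> = (\<Sum>i\<le>Suc N. b i * y ^ (i + 1))
      + (\<Sum>j\<le>N. (real j + 1) * coeff_a lam j N * y ^ (j + 2))"
    unfolding sum.atMost_Suc_shift by (simp add: sum.distrib distrib_right)
  also have "(\<Sum>i\<le>Suc N. b i * y ^ (i + 1))
      = (\<Sum>i\<le>N. (real N + (real i + 1) * lam) * coeff_a lam i N * y ^ (i + 1))"
    by (simp add: b_def)
  finally show ?thesis
    unfolding coeff_poly_def
    by (simp add: sum_distrib_left sum_distrib_right sum.distrib[symmetric]
        algebra_simps power2_eq_square del: coeff_a.simps)
qed

lemma F_has_real_derivative:
  assumes "lam \<noteq> 0" "t > -1" "t \<noteq> 0"
  shows "(F lam has_real_derivative - (lam * F lam t + (F lam t)\<^sup>2) / (1 + t)) (at t)"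
proof -
  define u where "u = (1 + t) powr lam"
  have "ln (1 + t) \<noteq> 0"
    using assms by simp
  then have "u \<noteq> 1"
    using assms by (simp add: u_def powr_def)
  have "(F lam has_real_derivative - (lam * (lam * (1 + t) powr (lam - 1)) / (u - 1)\<^sup>2)) (at t)"
    unfolding F_def[abs_def] using assms \<open>u \<noteq> 1\<close>
    by (auto intro!: derivative_eq_intros simp: u_def power2_eq_square powr_diff field_simps)
  \<comment> \<open>Both sides equal lam^2 u / ((1+t) (u-1)^2), because lam F + F^2 = lam^2 ((u-1) +
    1) / (u-1)^2.\<close>
  moreover have "lam * (lam * (1 + t) powr (lam - 1)) / (u - 1)\<^sup>2
      = (lam * F lam t + (F lam t)\<^sup>2) / (1 + t)"
    using assms \<open>u \<noteq> 1\<close> unfolding F_def u_def[symmetric]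
    by (simp add: powr_diff u_def[symmetric] divide_simps power2_eq_square) (simp add: algebra_simps)
  ultimately show ?thesis
    by (simp only: minus_divide_left)
qed

lemma coeff_poly_F_has_real_derivative:
  assumes "lam \<noteq> 0" "t > -1" "t \<noteq> 0"
  shows "((\<lambda>t. (-1) ^ N * coeff_poly lam N (F lam t) / (1 + t) ^ N) has_real_derivative
      (-1) ^ Suc N * coeff_poly lam (Suc N) (F lam t) / (1 + t) ^ Suc N) (at t)"
proof -
  define P' where "P' = (\<Sum>i\<le>N. coeff_a lam i N * (real (i + 1) * F lam t ^ i))"
  define R where "R = lam * F lam t + (F lam t)\<^sup>2"
  have "(coeff_poly lam N has_real_derivative P') (at (F lam t))"
    unfolding coeff_poly_def[abs_def] P'_def
  proof (intro DERIV_sum DERIV_cmult)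
    show "((\<lambda>y. y ^ (i + 1)) has_real_derivative real (i + 1) * F lam t ^ i) (at (F lam t))" for i
      using DERIV_pow[of "i + 1" "F lam t"] by (simp del: power_Suc)
  qed
  from DERIV_chain2[OF this F_has_real_derivative[OF assms]]
  have "((\<lambda>t. coeff_poly lam N (F lam t)) has_real_derivative P' * (- R / (1 + t))) (at t)"
    unfolding R_def .
  \<comment> \<open>Dividing by \<open>1 + t\<close> avoids the exponent \<open>N - 1\<close>, so
    \<open>N = 0\<close> needs no separate treatment later.\<close>
  moreover have "((\<lambda>t. (1 + t) ^ N) has_real_derivative real N * (1 + t) ^ N / (1 + t)) (at t)"
  proof -
    have "((\<lambda>t. (1 + t) ^ N) has_real_derivative real N * (1 + t) ^ (N - 1)) (at t)"
      by (auto intro!: derivative_eq_intros)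
    then show ?thesis
      using assms by (cases N) auto
  qed
  moreover have "(1 + t) ^ N \<noteq> 0"
    using assms by simp
  ultimately have "((\<lambda>t. (-1) ^ N * (coeff_poly lam N (F lam t) / (1 + t) ^ N)) has_real_derivative
      (-1) ^ N * ((P' * (- R / (1 + t)) * (1 + t) ^ N
        - coeff_poly lam N (F lam t) * (real N * (1 + t) ^ N / (1 + t)))
      / ((1 + t) ^ N * (1 + t) ^ N))) (at t)"
    by (intro DERIV_cmult DERIV_divide)
  \<comment> \<open>After cancellation the numerator is -(N P + P' R), where P is
    \<open>coeff_poly lam N\<close> at F; this is the right side of \<open>coeff_poly_Suc\<close> up
    to sign.\<close>
  moreover have "(P' * (- R / (1 + t)) * (1 + t) ^ N
        - coeff_poly lam N (F lam t) * (real N * (1 + t) ^ N / (1 + t)))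
      / ((1 + t) ^ N * (1 + t) ^ N)
      = - coeff_poly lam (Suc N) (F lam t) / (1 + t) ^ Suc N"
    using assms \<open>(1 + t) ^ N \<noteq> 0\<close>
    unfolding coeff_poly_Suc[of lam N] P'_def[symmetric] R_def[symmetric]
    by (simp add: divide_simps) (simp add: algebra_simps)
  ultimately have "((\<lambda>t. (-1) ^ N * (coeff_poly lam N (F lam t) / (1 + t) ^ N)) has_real_derivative
      (-1) ^ N * (- coeff_poly lam (Suc N) (F lam t) / (1 + t) ^ Suc N)) (at t)"
    by (simp only:)
  then show ?thesis
    by simp
qed

lemma higher_deriv_F:
  assumes "lam \<noteq> 0" "t > -1" "t \<noteq> 0"
  shows "(deriv ^^ N) (F lam) t = (-1) ^ N * coeff_poly lam N (F lam t) / (1 + t) ^ N"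
    and "(deriv ^^ N) (F lam) field_differentiable (at t)"
proof -
  define S where "S = {-1<..<0::real} \<union> {0<..}"
  define H where "H N t = (-1) ^ N * coeff_poly lam N (F lam t) / (1 + t) ^ N" for N t
  have "open S"
    by (auto simp: S_def)
  have H: "(H N has_real_derivative H (Suc N) t) (at t)" if "t \<in> S" for N t
    using coeff_poly_F_has_real_derivative[of lam t N] that assms(1)
    by (auto simp: H_def[abs_def] S_def)
  \<comment> \<open>A derivative at one point depends on nearby values, so the induction needs the
    closed form \<open>H N\<close> on the whole open set \<open>S\<close>, not only at the given
    point.\<close>
  have transfer: "((deriv ^^ N) (F lam) has_real_derivative H (Suc N) t) (at t)"
    if "\<And>s. s \<in> S \<Longrightarrow> (deriv ^^ N) (F lam) s = H N s" "t \<in> S" for N t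
    using has_field_derivative_transform_within_open[OF H \<open>open S\<close>] that by metis
  have eq: "t \<in> S \<Longrightarrow> (deriv ^^ N) (F lam) t = H N t" for N t
  proof (induction N arbitrary: t)
    case 0
    then show ?case
      by (simp add: H_def coeff_poly_def falling_factorial_def)
  next
    case (Suc N)
    then show ?case
      using transfer[of N t] by (simp add: DERIV_imp_deriv)
  qed
  have "t \<in> S"
    using assms by (auto simp: S_def)
  then show "(deriv ^^ N) (F lam) t = (-1) ^ N * coeff_poly lam N (F lam t) / (1 + t) ^ N"
    and "(deriv ^^ N) (F lam) field_differentiable (at t)"
    using eq transfer[of N t] by (auto simp: H_def field_differentiable_def)
qed

text \<open>Since \<open>deriv\<close> is a total operator, differentiability of all lower orders is
  included to certify that \<open>(deriv ^^ N) (F lam) t\<close> is a genuine N-th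
  derivative.\<close>

theorem theorem2p1:
  fixes lam t :: real and N :: nat
  assumes "lam \<noteq> 0"
    and "N \<ge> 1"
    and "t \<in> {-1<..<0} \<union> {0<..}"
  shows "(\<forall>k<N. (deriv ^^ k) (F lam) field_differentiable (at t))
    \<and> (-1) ^ N * (1 + t) ^ N * (deriv ^^ N) (F lam) t
        = (\<Sum>i = 0..N. coeff_a lam i N * F lam t ^ (i + 1))"
proof -
  have t: "t > -1" "t \<noteq> 0"
    using assms(3) by auto
  have "(-1) ^ N * (1 + t) ^ N * (deriv ^^ N) (F lam) t
      = ((-1) ^ N * (-1) ^ N) * coeff_poly lam N (F lam t)"
    using t higher_deriv_F(1)[OF assms(1) t, of N] by simp
  also have "(-1) ^ N * (-1) ^ N = (1::real)"
    by (simp flip: power_mult_distrib)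
  finally show ?thesis
    using higher_deriv_F(2)[OF assms(1) t] by (simp add: coeff_poly_def atMost_atLeast0)
qed

end
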